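(* For every integer $m\geq 1$, $$\frac{2^{2m}}{\binom{2m}{m}}=1+\sum_{l=0}^{m-1}\frac{\binom{m-1}{l}\binom{m}{l}}{\binom{2m-1}{2l}}.$$ *)

theory Defs
  imports Complex_Main
begin

end

theory Submission
  imports Defs "HOL-Computational_Algebra.Formal_Power_Series"
begin

text \<open>
  Write \<open>B k\<close> for the central binomial coefficient \<open>2 * k choose k\<close>. Expanding everything into
  factorials, the summand with index \<open>l < m\<close> equals \<open>B l * B (m - l) / B m\<close>
  (lemma \<open>summand_eq_central_product\<close>). The same product with \<open>l = m\<close> is \<open>1\<close>, so the
  right-hand side is the sum of \<open>B l * B (m - l)\<close> over all \<open>l \<le> m\<close>, divided by \<open>B m\<close>. That
  self-convolution equals \<open>4 ^ m\<close> (lemma \<open>central_binomial_convolution\<close>): as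
  \<open>B k = (-4) ^ k * (-1/2 gchoose k)\<close>, it is the Vandermonde identity for the exponents
  \<open>-1/2\<close> and \<open>-1/2\<close>, which add up to \<open>-1\<close>.
\<close>

lemma central_binomial_fact:
  "real ((2 * k) choose k) = fact (2 * k) / (fact k * fact k)"
  by (simp add: binomial_fact mult_2)

lemma central_binomial_Suc:
  "real ((2 * Suc k) choose Suc k) = real ((2 * k) choose k) * (2 * (2 * real k + 1) / (real k + 1))"
proof -
  have "fact (2 * Suc k) = (2 * real k + 2) * ((2 * real k + 1) * fact (2 * k))"
    by (simp add: algebra_simps)
  moreover have "fact (Suc k) = (real k + 1) * fact k"
    by (simp add: algebra_simps)
  ultimately show ?thesis
    unfolding central_binomial_fact by (simp add: divide_simps) (simp add: algebra_simps)
qed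

lemma central_binomial_eq_gbinomial:
  "real ((2 * k) choose k) = (-4) ^ k * ((-1/2) gchoose k)"
proof (induction k)
  case (Suc k)
  have "(real k + 1) * ((-1/2 :: real) gchoose Suc k) = (-1/2 - real k) * ((-1/2) gchoose k)"
    using gbinomial_mult_1[of "-1/2 :: real" k] by (simp add: algebra_simps)
  then have step: "((-1/2 :: real) gchoose Suc k) = (-1/2 - real k) * ((-1/2) gchoose k) / (real k + 1)"
    by (simp add: field_simps)
  show ?case
    unfolding central_binomial_Suc Suc.IH step by (simp add: divide_simps) (simp add: algebra_simps)
qed simp

lemma central_binomial_convolution:
  "(\<Sum>k = 0..n. real ((2 * k) choose k) * real ((2 * (n - k)) choose (n - k))) = 4 ^ n"
proof -
  have "(\<Sum>k = 0..n. real ((2 * k) choose k) * real ((2 * (n - k)) choose (n - k))) =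
      (\<Sum>k = 0..n. (-4) ^ n * (((-1/2) gchoose k) * ((-1/2) gchoose (n - k))))"
  proof (rule sum.cong[OF refl])
    fix k assume "k \<in> {0..n}"
    then have "(-4 :: real) ^ n = (-4) ^ k * (-4) ^ (n - k)"
      by (simp flip: power_add)
    then show "real ((2 * k) choose k) * real ((2 * (n - k)) choose (n - k)) =
        (-4) ^ n * (((-1/2) gchoose k) * ((-1/2) gchoose (n - k)))"
      unfolding central_binomial_eq_gbinomial by simp
  qed
  also have "\<dots> = (-4) ^ n * ((-1 :: real) gchoose n)"
    using gbinomial_Vandermonde[of "-1/2 :: real" "-1/2" n] by (simp flip: sum_distrib_left)
  also have "(-1 :: real) gchoose n = (-1) ^ n"
    using gbinomial_minus[of "1 :: real" n] by (simp flip: binomial_gbinomial)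
  also have "(-4 :: real) ^ n * (-1) ^ n = 4 ^ n"
    by (simp flip: power_mult_distrib)
  finally show ?thesis .
qed

text \<open>In factorials, both sides equal
  \<open>((m - 1)! m! / (2 m - 1)!) * ((2 l)! / (l!)^2) * ((2 d + 1)! / (d! (d + 1)!))\<close> with
  \<open>d = m - l - 1\<close>: the first factor is \<open>2 / (2 m choose m)\<close> and the last is half a central
  binomial coefficient.\<close>

lemma summand_eq_central_product:
  assumes "l < m"
  shows "real ((m - 1) choose l) * real (m choose l) / real ((2 * m - 1) choose (2 * l)) =
    real ((2 * l) choose l) * real ((2 * (m - l)) choose (m - l)) / real ((2 * m) choose m)"
proof -
  obtain d where m: "m = Suc (l + d)"
    using assms less_iff_Suc_add by auto
  have left: "real ((m - 1) choose l) = fact (l + d) / (fact l * fact d)"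
    "real (m choose l) = fact m / (fact l * fact (Suc d))"
    "real ((2 * m - 1) choose (2 * l)) =
      fact (2 * m - 1) / (fact (2 * l) * fact (2 * d + 1))"
    unfolding m by (simp_all add: binomial_fact Suc_diff_le)
  have split: "fact m = real m * fact (l + d)" "fact (Suc d) = (real d + 1) * fact d"
    "fact (2 * m) = 2 * real m * fact (2 * m - 1)"
    "fact (2 * (m - l)) = 2 * (real d + 1) * fact (2 * d + 1)" "m - l = Suc d"
    by (simp_all add: m algebra_simps)
  have pos: "real m > 0"
    by (simp add: m)
  show ?thesis
    unfolding left central_binomial_fact split using pos by (simp add: divide_simps)
qed

theorem mainTheorem6:
  fixes m :: nat
  assumes "m \<ge> 1"
  shows "2 ^ (2 * m) / real ((2 * m) choose m) =
    1 + (\<Sum>l = 0..m - 1. real ((m - 1) choose l) * real (m choose l) / real ((2 * m - 1) choose (2 * l)))"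
proof -
  let ?B = "\<lambda>k. real ((2 * k) choose k)"
  have "(\<Sum>l = 0..m - 1. real ((m - 1) choose l) * real (m choose l) / real ((2 * m - 1) choose (2 * l)))
      = (\<Sum>l = 0..m - 1. ?B l * ?B (m - l) / ?B m)"
    using assms by (intro sum.cong refl summand_eq_central_product) auto
  moreover have "(\<Sum>l = 0..m. ?B l * ?B (m - l) / ?B m) =
      (\<Sum>l = 0..m - 1. ?B l * ?B (m - l) / ?B m) + 1"
    using assms by (cases m) (simp_all del: binomial_Suc_Suc mult_Suc_right)
  moreover have "(\<Sum>l = 0..m. ?B l * ?B (m - l) / ?B m) = 2 ^ (2 * m) / ?B m"
    by (simp add: central_binomial_convolution power_mult flip: sum_divide_distrib)
  ultimately show ?thesis
    by simp
qed

end
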